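(* Let $k\ge1$, $p_1,\dots,p_k\in\mathbb{N}_0$, $m_1\in\mathbb{N}_0$, $m_2,\dots,m_{k+1}\in\mathbb{N}$, and $a_1,\dots,a_{k+1}\in[-1,1/2]\setminus\{0\}$. Put $M=m_1+\cdots+m_{k+1}$, $P=p_1+\cdots+p_k$. Then $$\mathrm{Li}_{\{1\}_{m_1},p_1+1,\{1\}_{m_2-1},\dots,p_k+1,\{1\}_{m_{k+1}-1}}(x)=(-1)^{M}\,\mathrm{Li}_{\{1\}_{M+P}}(y),$$ where $$x=\Big(a_1\diamond\{1\}_{m_1-1}\diamond\tfrac{a_2}{a_1},\{1\}_{m_2-1},\tfrac{a_3}{a_2},\{1\}_{m_3-1},\dots,\tfrac{a_{k+1}}{a_k},\{1\}_{m_{k+1}-1}\Big),$$ $$y=\Big(\tfrac{a_{k+1}}{a_{k+1}-1},A_1,A_2,\dots,A_k,\{1\}_{m_1-1}\Big),\qquad A_i=\Big(\{1\}_{m_{k+2-i}-1},\tfrac{a_{k+2-i}-1}{a_{k+2-i}}\diamond\{1\}_{p_{k+1-i}-1}\diamond\tfrac{a_{k+1-i}}{a_{k+1-i}-1}\Big),$$ with the convention $\{u\diamond\{1\}_{p-1}\diamond v\}=(u,\{1\}_{p-1},v)$ if $p\ge1$ and $=uv$ (a single entry) if $p=0$. If $m_1=0$, the final "$\{1\}_{m_1-1}=\{1\}_{-1}$" in $y$ means the last entry of $A_k$ is deleted, i.e. $A_k$ becomes $(\{1\}_{m_2-1},\tfrac{a_2-1}{a_2},\{1\}_{p_1-1})$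 if $p_1\ge1$ and $(\{1\}_{m_2-1})$ if $p_1=0$.
   Context: Multiple polylogarithms: $\mathrm{Li}_{s_1,\dots,s_r}(z_1,\dots,z_r)=\sum_{n_1>n_2>\cdots>n_r\ge1}\frac{z_1^{n_1}\cdots z_r^{n_r}}{n_1^{s_1}\cdots n_r^{s_r}}$. $\{1\}_d$ denotes $d$ consecutive entries equal to $1$ (empty if $d=0$); if $m_1=0$ the index on the left begins with $p_1+1$ and the first argument of $x$ is $a_2$. *)

theory Defs
  imports "HOL-Analysis.Analysis"
begin

definition mpl_indices :: "nat \<Rightarrow> nat \<Rightarrow> nat list set" where
  "mpl_indices r N = {ns. length ns = r \<and> sorted_wrt (>) ns \<and> set ns \<subseteq> {1..N}}"

definition mpl_partial :: "nat list \<Rightarrow> real list \<Rightarrow> nat \<Rightarrow> real" where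
  "mpl_partial s z N =
     (\<Sum>ns\<in>mpl_indices (length s) N. \<Prod>i<length s. z ! i ^ (ns ! i) / real (ns ! i) ^ (s ! i))"

text \<open>
  The multiple series need not converge absolutely (e.g. at \<open>z\<^sub>1 = -1\<close>, \<open>s\<^sub>1 = 1\<close>), so its value is
  the limit of the truncations at \<open>n\<^sub>1 \<le> N\<close>. Both definitions are meant for
  \<open>length z = length s\<close>; \<open>Li s z\<close> is unspecified unless \<open>Li_convergent s z\<close>.
\<close>

definition Li_convergent :: "nat list \<Rightarrow> real list \<Rightarrow> bool" where
  "Li_convergent s z \<longleftrightarrow> convergent (mpl_partial s z)"

definition Li :: "nat list \<Rightarrow> real list \<Rightarrow> real" where
  "Li s z = lim (mpl_partial s z)"

abbreviation ones :: "nat \<Rightarrow> 'a::one list" where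
  "ones d \<equiv> replicate d 1"

text \<open>\<open>diamond u p v\<close> is \<open>u \<diamondop> {1}\<^bsub>p-1\<^esub> \<diamondop> v\<close>; the argument is \<open>p\<close>, not \<open>p - 1\<close>.\<close>

definition diamond :: "real \<Rightarrow> nat \<Rightarrow> real \<Rightarrow> real list" where
  "diamond u p v = (if p = 0 then [u * v] else [u] @ ones (p - 1) @ [v])"

text \<open>
  The families \<open>p\<^sub>1, \<dots>, p\<^sub>k\<close>, \<open>m\<^sub>1, \<dots>, m\<^bsub>k+1\<^esub>\<close> and \<open>a\<^sub>1, \<dots>, a\<^bsub>k+1\<^esub>\<close> are functions on
  \<^typ>\<open>nat\<close> used only at these indices.
\<close>

definition lhs_index :: "nat \<Rightarrow> (nat \<Rightarrow> nat) \<Rightarrow> (nat \<Rightarrow> nat) \<Rightarrow> nat list" where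
  "lhs_index k p m =
     ones (m 1) @ concat (map (\<lambda>i. [p i + 1] @ ones (m (i + 1) - 1)) [1..<k + 1])"

definition x_args :: "nat \<Rightarrow> (nat \<Rightarrow> nat) \<Rightarrow> (nat \<Rightarrow> real) \<Rightarrow> real list" where
  "x_args k m a =
     diamond (a 1) (m 1) (a 2 / a 1) @ ones (m 2 - 1) @
     concat (map (\<lambda>i. [a (i + 1) / a i] @ ones (m (i + 1) - 1)) [2..<k + 1])"

definition A_block :: "nat \<Rightarrow> (nat \<Rightarrow> nat) \<Rightarrow> (nat \<Rightarrow> nat) \<Rightarrow> (nat \<Rightarrow> real) \<Rightarrow> nat \<Rightarrow> real list" where
  "A_block k p m a i =
     ones (m (k + 2 - i) - 1) @
     diamond ((a (k + 2 - i) - 1) / a (k + 2 - i))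
             (p (k + 1 - i))
             (a (k + 1 - i) / (a (k + 1 - i) - 1))"

text \<open>
  For \<open>m\<^sub>1 = 0\<close> the trailing \<open>{1}\<^bsub>-1\<^esub>\<close> deletes the last entry of \<open>A\<^sub>k\<close>; this is the last entry of
  the whole list, since every \<open>A\<^sub>i\<close> is nonempty.
\<close>

definition y_args :: "nat \<Rightarrow> (nat \<Rightarrow> nat) \<Rightarrow> (nat \<Rightarrow> nat) \<Rightarrow> (nat \<Rightarrow> real) \<Rightarrow> real list" where
  "y_args k p m a =
     (let y = [a (k + 1) / (a (k + 1) - 1)] @ concat (map (A_block k p m a) [1..<k + 1])
      in if m 1 = 0 then butlast y else y @ ones (m 1 - 1))"

end

theory Submission
  imports Defs
begin

text \<open>
  A multiple polylogarithm is the iterated integral from \<open>0\<close> to \<open>1\<close> of a word in the forms \<open>dt / t\<close>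
  and \<open>b dt / (1 - b t)\<close>, where \<open>b\<close> runs through the partial products of the arguments.  The substitution
  \<open>t \<mapsto> 1 - t\<close> reverses the word, turns \<open>dt / t\<close> into the form of \<open>b = 1\<close> and the form of \<open>b\<close> into
  minus that of \<open>b / (b - 1)\<close>; this maps the word of the left-hand side to that of the right-hand side.

  The substitution is carried out on power series instead of integrals.  If \<open>F\<^sub>w\<close> is the series of the
  word \<open>w\<close> and \<open>\<tau>\<close> denotes the signed reversal, the sum of \<open>F\<^bsub>\<tau> u\<^esub> (1 - x) F\<^sub>v (x)\<close> over all splittings
  \<open>w = u v\<close> has derivative \<open>0\<close>, and by Abel's limit theorem it tends to the two sides of the identity as
  \<open>x\<close> tends to \<open>0\<close> and \<open>1\<close>.
\<close>

section \<open>Abel summation\<close>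

lemma summable_powser_bounded:
  fixes d :: "nat \<Rightarrow> real"
  assumes "\<And>n. \<bar>d n\<bar> \<le> B" and "\<bar>t\<bar> < 1"
  shows "summable (\<lambda>n. norm (d n * t ^ n))"
proof (rule summable_comparison_test')
  show "summable (\<lambda>n. B * \<bar>t\<bar> ^ n)"
    using assms(2) by (intro summable_mult summable_geometric) auto
  show "norm (norm (d n * t ^ n)) \<le> B * \<bar>t\<bar> ^ n" if "n \<ge> 0" for n
    using assms(1)[of n] by (auto simp: abs_mult power_abs intro: mult_right_mono)
qed

lemma null_sequence_bounded:
  fixes d :: "nat \<Rightarrow> real"
  assumes "d \<longlonglongrightarrow> 0"
  obtains B where "\<And>n. \<bar>d n\<bar> \<le> B"
  using convergent_imp_Bseq[OF convergentI[OF assms]] by (auto simp: Bseq_def)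

text \<open>The first \<open>N\<close> terms contribute at most the constant \<open>S\<close>, which
  the factor \<open>1 - t\<close> kills; the rest is at most \<open>e / 2\<close> times the
  geometric series, whose sum \<open>1 / (1 - t)\<close> the factor cancels.\<close>

lemma one_minus_times_powser_tendsto_0:
  fixes d :: "nat \<Rightarrow> real"
  assumes d: "d \<longlonglongrightarrow> 0"
  shows "((\<lambda>t. (1 - t) * (\<Sum>n. d n * t ^ n)) \<longlongrightarrow> 0) (at_left 1)"
proof (rule tendstoI)
  fix e :: real assume e: "e > 0"
  obtain B where B: "\<And>n. \<bar>d n\<bar> \<le> B" using null_sequence_bounded[OF d] by blast
  from d e have "\<forall>\<^sub>F n in sequentially. \<bar>d n\<bar> < e / 2"
    by (auto simp: tendsto_iff dist_real_def dest!: spec[of _ "e / 2"])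
  then obtain N where N: "\<And>n. n \<ge> N \<Longrightarrow> \<bar>d n\<bar> < e / 2"
    by (auto simp: eventually_sequentially)
  define S where "S = (\<Sum>n<N. \<bar>d n\<bar>)"
  have "((\<lambda>t. (1 - t) * S) \<longlongrightarrow> (1 - 1) * S) (at_left (1::real))"
    by (intro tendsto_intros)
  then have "\<forall>\<^sub>F t in at_left 1. (1 - t) * S < e / 2"
    using e by (intro order_tendstoD(2)) auto
  moreover have "\<forall>\<^sub>F t in at_left (1::real). t \<in> {0<..<1}"
    using eventually_at_left_real[of 0 1] by simp
  ultimately show "\<forall>\<^sub>F t in at_left 1. dist ((1 - t) * (\<Sum>n. d n * t ^ n)) 0 < e"
  proof eventually_elim
    case (elim t)
    then have t: "0 < t" "t < 1" by auto
    have sm: "summable (\<lambda>n. norm (d n * t ^ n))"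
      using summable_powser_bounded[OF B] t by simp
    have geo: "(\<lambda>n. t ^ n) sums (1 / (1 - t))" using t by (intro geometric_sums) auto
    have fin: "(\<lambda>n. if n \<in> {..<N} then \<bar>d n\<bar> else 0) sums S"
      unfolding S_def by (rule sums_If_finite_set) simp
    have dom: "(\<lambda>n. (if n \<in> {..<N} then \<bar>d n\<bar> else 0) + e / 2 * t ^ n) sums (S + e / 2 * (1 / (1 - t)))"
      by (intro sums_add fin sums_mult geo)
    have le: "norm (d n * t ^ n) \<le> (if n \<in> {..<N} then \<bar>d n\<bar> else 0) + e / 2 * t ^ n" for n
    proof (cases "n < N")
      case True
      have "\<bar>d n\<bar> * t ^ n \<le> \<bar>d n\<bar>" using t by (simp add: mult_left_le power_le_one)
      moreover have "0 \<le> e / 2 * t ^ n" using e t by simp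
      ultimately show ?thesis using True t by (simp add: abs_mult)
    next
      case False
      then show ?thesis using N[of n] t by (auto simp: abs_mult intro!: mult_right_mono)
    qed
    have "\<bar>\<Sum>n. d n * t ^ n\<bar> \<le> (\<Sum>n. norm (d n * t ^ n))"
      using summable_norm[OF sm] by simp
    also have "\<dots> \<le> S + e / 2 * (1 / (1 - t))"
      using suminf_le[OF le sm sums_summable[OF dom]] dom by (simp add: sums_iff)
    finally have "(1 - t) * \<bar>\<Sum>n. d n * t ^ n\<bar> \<le> (1 - t) * (S + e / 2 * (1 / (1 - t)))"
      using t by (intro mult_left_mono) auto
    also have "\<dots> = (1 - t) * S + e / 2" using t by (simp add: field_simps)
    also have "\<dots> < e" using elim by simp
    finally show ?case using t by (simp add: abs_mult)
  qed
qed

text \<open>Summation by parts: \<open>c n\<close> is a difference of consecutive errors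
  \<open>d n\<close> of the partial sums, and the series becomes
  \<open>s + (1 - t) * (\<Sum>n. d n * t ^ n)\<close>.\<close>

theorem Abel_limit:
  fixes c :: "nat \<Rightarrow> real"
  assumes c: "c sums s"
  shows "((\<lambda>t. \<Sum>n. c n * t ^ n) \<longlongrightarrow> s) (at_left 1)"
proof -
  define d where "d n = (\<Sum>i\<le>n. c i) - s" for n
  have d: "d \<longlonglongrightarrow> 0"
    using c unfolding d_def sums_def_le by (simp add: LIM_zero_iff)
  obtain B where B: "\<And>n. \<bar>d n\<bar> \<le> B" using null_sequence_bounded[OF d] by blast
  have eq: "(\<Sum>n. c n * t ^ n) = s + (1 - t) * (\<Sum>n. d n * t ^ n)" if t: "0 < t" "t < 1" for t
  proof -
    have sd: "summable (\<lambda>n. d n * t ^ n)"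
      using summable_powser_bounded[OF B, of t] t by (auto intro: summable_norm_cancel)
    \<comment> \<open>\<open>e\<close> is \<open>d\<close> shifted by one; its value
      \<open>- s\<close> at 0 is the error of the empty partial sum, so
      \<open>c n = d n - e n\<close> holds from \<open>n = 0\<close> on.\<close>
    define e where "e n = (case n of 0 \<Rightarrow> - s | Suc k \<Rightarrow> d k)" for n
    have ce: "c n * t ^ n = d n * t ^ n - e n * t ^ n" for n
      by (cases n) (simp_all add: d_def e_def algebra_simps)
    have e: "(\<lambda>n. e n * t ^ n) sums (- s + t * (\<Sum>n. d n * t ^ n))"
    proof -
      have "(\<lambda>n. e (Suc n) * t ^ Suc n) sums (t * (\<Sum>n. d n * t ^ n))"
        using sums_mult[OF summable_sums[OF sd], of t] by (simp add: e_def mult_ac)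
      from sums_Suc[OF this] show ?thesis by (simp add: e_def add.commute)
    qed
    have "(\<lambda>n. c n * t ^ n) sums ((\<Sum>n. d n * t ^ n) - (- s + t * (\<Sum>n. d n * t ^ n)))"
      unfolding ce by (intro sums_diff summable_sums sd e)
    then show ?thesis by (simp add: sums_iff algebra_simps)
  qed
  have "((\<lambda>t. s + (1 - t) * (\<Sum>n. d n * t ^ n)) \<longlongrightarrow> s + 0) (at_left 1)"
    by (intro tendsto_add tendsto_const one_minus_times_powser_tendsto_0 d)
  moreover have "\<forall>\<^sub>F t in at_left 1. s + (1 - t) * (\<Sum>n. d n * t ^ n) = (\<Sum>n. c n * t ^ n)"
    using eventually_at_left_real[of 0 1] by (auto elim!: eventually_mono simp: eq)
  ultimately show ?thesis by (simp add: tendsto_cong)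
qed

section \<open>Words of differential forms\<close>

text \<open>
  A word lists the forms of an iterated integral from \<open>0\<close> to \<open>x\<close>, outermost first: the letter
  \<open>0\<close> stands for \<open>dt / t\<close> and a letter \<open>b \<noteq> 0\<close> for \<open>b dt / (1 - b t)\<close>.  The integral is the power
  series with coefficients \<open>word_coeff w\<close>.
\<close>

fun word_coeff :: "real list \<Rightarrow> nat \<Rightarrow> real" where
  "word_coeff [] n = (if n = 0 then 1 else 0)"
| "word_coeff (b # w) n =
     (if b = 0 then word_coeff w n else (\<Sum>j<n. b ^ (n - j) * word_coeff w j)) / real n"

definition word_series :: "real list \<Rightarrow> real \<Rightarrow> real" where
  "word_series w x = (\<Sum>n. word_coeff w n * x ^ n)"

definition form_density :: "real \<Rightarrow> real \<Rightarrow> real" where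
  "form_density b x = (if b = 0 then 1 / x else b / (1 - b * x))"

section \<open>Decay of the coefficients\<close>

lemma word_coeff_0 [simp]: "w \<noteq> [] \<Longrightarrow> word_coeff w 0 = 0"
  by (cases w) auto

text \<open>With \<open>u = sqrt n\<close> and \<open>v = sqrt (n + 1)\<close>, the inequality
  \<open>2 * u * v \<le> u ^ 2 + v ^ 2\<close> gives \<open>1 / v \<le> 2 * (v - u)\<close>, which
  telescopes.\<close>

lemma sum_inverse_sqrt_le: "(\<Sum>j<n. 1 / sqrt (real (Suc j))) \<le> 2 * sqrt (real n)"
proof (induction n)
  case (Suc n)
  define u v where "u = sqrt (real n)" and "v = sqrt (real (Suc n))"
  have v: "v > 0" and uv: "v\<^sup>2 = u\<^sup>2 + 1" by (auto simp: u_def v_def)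
  have "2 * u * v \<le> u\<^sup>2 + v\<^sup>2" using sum_squares_bound[of u v] by simp
  then have "2 * u * v + 1 \<le> 2 * v\<^sup>2" using uv by simp
  then have "2 * u + 1 / v \<le> 2 * v" using v by (simp add: field_simps power2_eq_square)
  then show ?case using Suc by (simp add: u_def v_def)
qed simp

text \<open>Each letter preserves the decay rate: summing \<open>1 / sqrt (j + 1)\<close> over
  \<open>j < n\<close> costs \<open>2 * sqrt n\<close>, and the division by \<open>n\<close>
  restores \<open>1 / sqrt n\<close>. A rate \<open>1 / n\<close> would not survive, since harmonic
  sums add logarithms.\<close>

lemma word_coeff_bound:
  assumes "set w \<subseteq> {-1..1}"
  shows "\<exists>C\<ge>0. \<forall>n. \<bar>word_coeff w n\<bar> \<le> C / sqrt (real (Suc n))"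
  using assms
proof (induction w)
  case Nil
  show ?case by (intro exI[of _ 1]) auto
next
  case (Cons b w)
  then obtain C where C: "C \<ge> 0" "\<And>n. \<bar>word_coeff w n\<bar> \<le> C / sqrt (real (Suc n))" by auto
  have b: "\<bar>b\<bar> \<le> 1" using Cons.prems by auto
  have "\<bar>word_coeff (b # w) n\<bar> \<le> 3 * C / sqrt (real (Suc n))" for n
  proof (cases "n = 0")
    case True
    then show ?thesis using C(1) by simp
  next
    case False
    then have n: "real n \<ge> 1" by simp
    show ?thesis
    proof (cases "b = 0")
      case True
      have "\<bar>word_coeff w n\<bar> / real n \<le> \<bar>word_coeff w n\<bar>" using n by (simp add: divide_le_eq mult_le_cancel_left1)
      also have "\<dots> \<le> C / sqrt (real (Suc n))" by (rule C)
      also have "\<dots> \<le> 3 * C / sqrt (real (Suc n))" using C(1) by (intro divide_right_mono) auto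
      finally show ?thesis using True by simp
    next
      case False
      have "\<bar>\<Sum>j<n. b ^ (n - j) * word_coeff w j\<bar> \<le> (\<Sum>j<n. \<bar>b ^ (n - j) * word_coeff w j\<bar>)"
        by (rule sum_abs)
      also have "\<dots> \<le> (\<Sum>j<n. C * (1 / sqrt (real (Suc j))))"
      proof (rule sum_mono)
        fix j
        have "\<bar>b ^ (n - j) * word_coeff w j\<bar> \<le> 1 * \<bar>word_coeff w j\<bar>"
          unfolding abs_mult power_abs using b by (intro mult_right_mono power_le_one) auto
        then show "\<bar>b ^ (n - j) * word_coeff w j\<bar> \<le> C * (1 / sqrt (real (Suc j)))"
          using C(2)[of j] by simp
      qed
      also have "\<dots> = C * (\<Sum>j<n. 1 / sqrt (real (Suc j)))" by (simp add: sum_distrib_left)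
      also have "\<dots> \<le> C * (2 * sqrt (real n))" by (intro mult_left_mono sum_inverse_sqrt_le C)
      finally have "\<bar>word_coeff (b # w) n\<bar> \<le> C * (2 * sqrt (real n)) / real n"
        using False n by (simp add: divide_right_mono)
      also have "\<dots> = 2 * C / sqrt (real n)"
        using n by (simp add: field_simps)
      \<comment> \<open>The 3 absorbs the shift from \<open>n\<close> to \<open>n + 1\<close>:
        \<open>4 * (n + 1) \<le> 9 * n\<close> for \<open>n \<ge> 1\<close>.\<close>
      also have "\<dots> \<le> 3 * C / sqrt (real (Suc n))"
      proof -
        have "2 * sqrt (real (Suc n)) = sqrt (4 * real (Suc n))" by (simp add: real_sqrt_mult del: of_nat_Suc)
        also have "\<dots> \<le> sqrt (9 * real n)" using n by (intro real_sqrt_le_mono) simp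
        also have "\<dots> = 3 * sqrt (real n)" by (simp add: real_sqrt_mult)
        finally have "C * (2 * sqrt (real (Suc n))) \<le> C * (3 * sqrt (real n))"
          using C(1) by (rule mult_left_mono)
        then show ?thesis using n by (simp add: field_simps)
      qed
      finally show ?thesis .
    qed
  qed
  then show ?case using C(1) by (intro exI[of _ "3 * C"]) auto
qed

lemma word_coeff_tendsto_0:
  assumes "set w \<subseteq> {-1..1}"
  shows "word_coeff w \<longlonglongrightarrow> 0"
proof -
  obtain C where C: "\<And>n. \<bar>word_coeff w n\<bar> \<le> C / sqrt (real (Suc n))"
    using word_coeff_bound[OF assms] by auto
  have "filterlim (\<lambda>n. sqrt (real (Suc n))) at_top sequentially"
    by (intro filterlim_compose[OF sqrt_at_top] filterlim_compose[OF filterlim_real_sequentially] filterlim_Suc)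
  then have "(\<lambda>n. C / sqrt (real (Suc n))) \<longlonglongrightarrow> 0"
    by (intro tendsto_divide_0[OF tendsto_const] filterlim_at_top_imp_at_infinity)
  then show ?thesis
    by (rule Lim_null_comparison[rotated]) (use C in auto)
qed

lemma summable_word_series:
  assumes "set w \<subseteq> {-1..1}" and "\<bar>x\<bar> < 1"
  shows "summable (\<lambda>n. norm (word_coeff w n * x ^ n))"
  using null_sequence_bounded[OF word_coeff_tendsto_0[OF assms(1)]] summable_powser_bounded assms(2)
  by metis

section \<open>The differential equation of a word series\<close>

lemma word_series_Nil [simp]: "word_series [] x = 1"
  unfolding word_series_def using powser_sums_if[of 0 x] by (simp add: sums_iff if_distrib)

text \<open>Differentiation strips the outermost letter; for \<open>b \<noteq> 0\<close> this is a
  Cauchy product with a geometric series. The condition on the last letter excludes the word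
  \<open>[0]\<close>, whose coefficients all vanish (division by \<open>real 0\<close> is 0) while
  the integral of \<open>dt / t\<close> from 0 diverges.\<close>

lemma word_series_has_derivative:
  assumes w: "set (b # w) \<subseteq> {-1..1}" and last: "last (b # w) \<noteq> 0" and x: "0 < x" "x < 1"
  shows "(word_series (b # w) has_real_derivative form_density b x * word_series w x) (at x)"
proof -
  have "((\<lambda>x. \<Sum>n. word_coeff (b # w) n * x ^ n) has_real_derivative
          (\<Sum>n. diffs (word_coeff (b # w)) n * x ^ n)) (at x)"
  proof (rule termdiffs_strong')
    show "summable (\<lambda>n. word_coeff (b # w) n * z ^ n)" if "norm z < 1" for z :: real
      using summable_word_series[OF w, of z] that by (auto intro: summable_norm_cancel)
  qed (use x in auto)
  moreover have "(\<lambda>n. diffs (word_coeff (b # w)) n * x ^ n) sums (form_density b x * word_series w x)"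
  proof (cases "b = 0")
    case True
    then have "w \<noteq> []" using last by auto
    have "(\<lambda>n. word_coeff w n * x ^ n) sums word_series w x"
      unfolding word_series_def using summable_word_series[of w x] w x
      by (intro summable_sums) (auto intro: summable_norm_cancel)
    then have "(\<lambda>n. word_coeff w (Suc n) * x ^ Suc n) sums word_series w x"
      using \<open>w \<noteq> []\<close> by (subst sums_Suc_iff) simp
    from sums_divide[OF this, of x] have "(\<lambda>n. word_coeff w (Suc n) * x ^ n) sums (word_series w x / x)"
      using x by simp
    then show ?thesis using True by (simp add: diffs_def form_density_def del: of_nat_Suc)
  next
    case False
    have bx: "\<bar>b * x\<bar> < 1"
      using w x mult_le_one[of "\<bar>b\<bar>" x] by (auto simp: abs_mult intro: le_less_trans[OF mult_left_le_one_le])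
    have "(\<lambda>n. \<Sum>i\<le>n. (word_coeff w i * x ^ i) * (b * x) ^ (n - i)) sums
           (word_series w x * (\<Sum>n. (b * x) ^ n))"
      unfolding word_series_def using w x bx
      by (intro Cauchy_product_sums summable_word_series) (auto simp: norm_power power_abs)
    moreover have "(\<Sum>n. (b * x) ^ n) = 1 / (1 - b * x)" using bx by (simp add: suminf_geometric)
    ultimately have "(\<lambda>n. b * (\<Sum>i\<le>n. (word_coeff w i * x ^ i) * (b * x) ^ (n - i))) sums
           (b * (word_series w x * (1 / (1 - b * x))))"
      by (intro sums_mult) simp
    moreover have "b * (\<Sum>i\<le>n. (word_coeff w i * x ^ i) * (b * x) ^ (n - i)) =
        diffs (word_coeff (b # w)) n * x ^ n" for n
    proof -
      have "b * ((word_coeff w i * x ^ i) * (b * x) ^ (n - i)) =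
             b ^ (Suc n - i) * word_coeff w i * x ^ n" if "i \<le> n" for i
      proof -
        have "x ^ n = x ^ i * x ^ (n - i)" using that by (simp flip: power_add)
        then show ?thesis using that by (simp add: Suc_diff_le power_mult_distrib)
      qed
      then have "b * (\<Sum>i\<le>n. (word_coeff w i * x ^ i) * (b * x) ^ (n - i)) =
          (\<Sum>i\<le>n. b ^ (Suc n - i) * word_coeff w i * x ^ n)"
        unfolding sum_distrib_left by (intro sum.cong) auto
      then show ?thesis using False
        by (simp add: diffs_def sum_distrib_right lessThan_Suc_atMost
            del: sum.lessThan_Suc sum.atMost_Suc of_nat_Suc)
    qed
    ultimately show ?thesis using False by (simp add: form_density_def mult_ac)
  qed
  ultimately show ?thesis by (simp add: word_series_def[abs_def] sums_iff)
qed

section \<open>Convergence at the endpoint 1\<close>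

lemma summable_inverse_n_sqrt: "summable (\<lambda>n. C / (real n * sqrt (real n)))"
proof -
  have "summable (\<lambda>n. C * real n powr (- 3 / 2))"
    by (intro summable_mult) (simp add: summable_real_powr_iff)
  moreover have "C * real n powr (- 3 / 2) = C / (real n * sqrt (real n))" for n
  proof (cases "n = 0")
    case False
    then have "real n powr (- 3 / 2) = inverse (real n powr (1 + 1 / 2))" by (simp flip: powr_minus)
    also have "real n powr (1 + 1 / 2) = real n * sqrt (real n)"
      using False by (simp only: powr_add) (simp add: powr_half_sqrt)
    finally show ?thesis by (simp add: field_simps)
  qed simp
  ultimately show ?thesis by (simp only:)
qed

text \<open>The extra division improves the decay to \<open>n powr (- 3 / 2)\<close>. Shifts by 0
  and by 1 both occur in the recursion for the coefficients.\<close>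

lemma summable_word_coeff_shift_over_n:
  assumes "set w \<subseteq> {-1..1}"
  shows "summable (\<lambda>n. word_coeff w (n + k) / real n)"
proof -
  obtain C where C: "C \<ge> 0" "\<And>n. \<bar>word_coeff w n\<bar> \<le> C / sqrt (real (Suc n))"
    using word_coeff_bound[OF assms] by auto
  show ?thesis
  proof (rule summable_comparison_test'[OF summable_inverse_n_sqrt[of C], of 1])
    fix n :: nat assume n: "n \<ge> 1"
    have "\<bar>word_coeff w (n + k)\<bar> \<le> C / sqrt (real (Suc (n + k)))" by (rule C)
    also have "\<dots> \<le> C / sqrt (real n)" using C n by (intro divide_left_mono) auto
    finally have "\<bar>word_coeff w (n + k)\<bar> / real n \<le> C / sqrt (real n) / real n"
      by (rule divide_right_mono) simp
    then show "norm (word_coeff w (n + k) / real n) \<le> C / (real n * sqrt (real n))"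
      by (simp add: mult.commute)
  qed
qed

text \<open>A first letter 0 supplies a factor \<open>1 / n\<close> and hence absolute convergence.
  Otherwise convergence may be only conditional, as for \<open>[-1]\<close>; it is obtained for
  \<open>(1 - b) * e n\<close>, and \<open>b \<noteq> 1\<close> lets the factor be
  cancelled.\<close>

lemma summable_word_coeff:
  assumes w: "set w \<subseteq> {-1..1}" "w \<noteq> []" "hd w \<noteq> 1"
  shows "summable (word_coeff w)"
proof -
  obtain b v where bv: "w = b # v" using w(2) by (cases w) auto
  then have v: "set v \<subseteq> {-1..1}" using w by auto
  show ?thesis
  proof (cases "b = 0")
    case True
    then have "word_coeff w = (\<lambda>n. word_coeff v n / real n)" by (simp add: bv fun_eq_iff)
    then show ?thesis using summable_word_coeff_shift_over_n[OF v, of 0] by simp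
  next
    case False
    define e where "e = word_coeff w"
    \<comment> \<open>The recursion for \<open>n e\<^sub>n\<close> expresses \<open>e\<^bsub>n+1\<^esub> - b e\<^sub>n\<close>, which is \<open>(1 - b) e\<^sub>n\<close> plus a
      telescoping term, through absolutely summable sequences.\<close>
    have rec: "e (Suc n) - b * e n = b * (word_coeff v n / real n) - e (n + 1) / real n"
      if "n \<ge> 1" for n
    proof -
      define d where "d n = (\<Sum>j<n. b ^ (n - j) * word_coeff v j)" for n
      have "d (Suc n) = b * word_coeff v n + (\<Sum>j<n. b * (b ^ (n - j) * word_coeff v j))"
        by (simp add: d_def Suc_diff_le mult.assoc)
      then have d: "d (Suc n) = b * (d n + word_coeff v n)"
        by (simp add: d_def sum_distrib_left algebra_simps)
      have e: "e n = d n / real n" for n using False by (simp add: e_def bv d_def)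
      have "e (Suc n) * real (Suc n) = d (Suc n)" "e n * real n = d n" using that by (simp_all add: e)
      with d have "e (Suc n) * (real n + 1) = b * (e n * real n + word_coeff v n)" by (simp add: add.commute)
      then show ?thesis using that by (simp add: field_simps)
    qed
    have "summable (\<lambda>n. b * (word_coeff v n / real n) - e (n + 1) / real n)"
      using summable_word_coeff_shift_over_n[OF v, of 0] summable_word_coeff_shift_over_n[OF w(1), of 1]
      unfolding e_def by (intro summable_diff summable_mult) simp_all
    then have "summable (\<lambda>n. e (Suc n) - b * e n)"
      by (rule summable_cong[THEN iffD2, rotated]) (auto simp: eventually_sequentially rec intro!: exI[of _ 1])
    moreover have "summable (\<lambda>n. e (Suc n) - e n)"
      using telescope_summable word_coeff_tendsto_0[OF w(1)] unfolding e_def by blast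
    ultimately have "summable (\<lambda>n. (e (Suc n) - b * e n) - (e (Suc n) - e n))" by (rule summable_diff)
    then have "summable (\<lambda>n. (1 - b) * e n)" by (simp add: algebra_simps)
    then have "summable e" using w(3) by (simp add: bv summable_cmult_iff)
    then show ?thesis by (simp add: e_def)
  qed
qed

section \<open>Duality\<close>

definition dual_letter :: "real \<Rightarrow> real" where
  "dual_letter b = (if b = 0 then 1 else b / (b - 1))"

definition dual_word :: "real list \<Rightarrow> real list" where
  "dual_word w = rev (map dual_letter w)"

definition dual_sign :: "real list \<Rightarrow> real" where
  "dual_sign w = (-1) ^ length (filter (\<lambda>b. b \<noteq> 0) w)"

text \<open>The endpoint \<open>1 / 2\<close> comes from here: for \<open>0 < b < 1\<close>, the
  bound \<open>b / (b - 1) \<ge> -1\<close> holds exactly when \<open>b \<le> 1 / 2\<close>.\<close>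

lemma dual_letter_range: "b \<in> {-1..1/2} \<Longrightarrow> dual_letter b \<in> {-1..1}"
  by (auto simp: dual_letter_def divide_simps)

lemma dual_letter_nonzero: "b \<in> {-1..1/2} \<Longrightarrow> dual_letter b \<noteq> 0"
  by (auto simp: dual_letter_def)

text \<open>Reversal puts the dual of the last letter first, so this gives the condition of
  \<open>summable_word_coeff\<close> on the head of the dual word.\<close>

lemma dual_letter_neq_1: "b \<noteq> 0 \<Longrightarrow> dual_letter b \<noteq> 1"
  by (auto simp: dual_letter_def divide_simps)

lemma dual_word_range: "set w \<subseteq> {-1..1/2} \<Longrightarrow> set (dual_word w) \<subseteq> {-1..1}"
  using dual_letter_range by (auto simp: dual_word_def simp del: atLeastAtMost_iff)

lemma dual_word_eq_Nil_iff [simp]: "dual_word w = [] \<longleftrightarrow> w = []"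
  by (simp add: dual_word_def)

text \<open>For \<open>b \<noteq> 0\<close> the denominators agree up to a constant,
  \<open>1 - b / (b - 1) * (1 - x) = (1 - b * x) / (1 - b)\<close>; the leftover
  \<open>(1 - b) / (b - 1)\<close> is the sign counted by \<open>dual_sign\<close>.\<close>

lemma form_density_dual:
  assumes "b \<in> {-1..1/2}" "0 < x" "x < 1"
  shows "form_density b x = (if b = 0 then 1 else -1) * form_density (dual_letter b) (1 - x)"
proof (cases "b = 0")
  case True
  then show ?thesis by (simp add: form_density_def dual_letter_def)
next
  case False
  have "b * x < 1"
    using assms mult_mono[of b "1/2" x 1] by auto
  then have 1: "1 - b * x \<noteq> 0" and 2: "b - 1 \<noteq> 0" using assms by auto
  have "1 - b / (b - 1) * (1 - x) = (1 - b * x) / (1 - b)"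
    using 2 by (simp add: field_simps)
  then have "form_density (dual_letter b) (1 - x) = b / (b - 1) / ((1 - b * x) / (1 - b))"
    using False 2 by (simp add: form_density_def dual_letter_def)
  also have "\<dots> = b / (1 - b * x) * ((1 - b) / (b - 1))" by simp
  also have "(1 - b) / (b - 1) = - 1" using 2 by (simp add: divide_simps)
  finally show ?thesis using False by (simp add: form_density_def)
qed

text \<open>\<open>word_series v\<close> may blow up at 1, but slower than
  \<open>1 / (1 - x)\<close> because its coefficients tend to 0; the series of a nonempty
  \<open>u\<close> vanishes at 0, which supplies the factor \<open>1 - x\<close>.\<close>

lemma word_series_cross_term_tendsto_0:
  assumes u: "set u \<subseteq> {-1..1}" "u \<noteq> []" and v: "set v \<subseteq> {-1..1}"
  shows "((\<lambda>x. word_series u (1 - x) * word_series v x) \<longlongrightarrow> 0) (at_left 1)"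
proof -
  define Q where "Q y = (\<Sum>n. word_coeff u (Suc n) * y ^ n)" for y
  have su: "summable (\<lambda>n. word_coeff u n * y ^ n)" if "\<bar>y\<bar> < 1" for y
    using summable_word_series[OF u(1) that] by (rule summable_norm_cancel)
  have Q: "word_series u y = y * Q y" if "\<bar>y\<bar> < 1" for y
    using powser_split_head(1)[OF su[OF that]] u(2) by (simp add: word_series_def Q_def)
  have "isCont Q 0" unfolding Q_def
  proof (rule isCont_powser)
    show "summable (\<lambda>n. word_coeff u (Suc n) * (1 / 2) ^ n)"
      using powser_split_head(3)[OF su[of "1/2"]] by simp
  qed simp
  moreover have "((\<lambda>x::real. 1 - x) \<longlongrightarrow> 1 - 1) (at_left 1)" by (intro tendsto_intros)
  ultimately have "((\<lambda>x. Q (1 - x)) \<longlongrightarrow> Q 0) (at_left 1)"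
    using isCont_tendsto_compose[of 0 Q "\<lambda>x. 1 - x" "at_left 1"] by simp
  then have "((\<lambda>x. Q (1 - x) * ((1 - x) * word_series v x)) \<longlongrightarrow> Q 0 * 0) (at_left 1)"
    unfolding word_series_def
    by (intro tendsto_mult one_minus_times_powser_tendsto_0 word_coeff_tendsto_0 v)
  moreover have "\<forall>\<^sub>F x in at_left 1. Q (1 - x) * ((1 - x) * word_series v x) = word_series u (1 - x) * word_series v x"
    using eventually_at_left_real[of 0 1] by (auto elim!: eventually_mono simp: Q)
  ultimately show ?thesis by (simp add: tendsto_cong)
qed

text \<open>
  Cutting the path from \<open>0\<close> to \<open>1\<close> at \<open>x\<close>: the part from \<open>x\<close> to \<open>1\<close> is reversed by \<open>t \<mapsto> 1 - t\<close>.
\<close>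

definition split_sum :: "real list \<Rightarrow> real \<Rightarrow> real" where
  "split_sum w x = (\<Sum>i\<le>length w. dual_sign (take i w) *
      (word_series (dual_word (take i w)) (1 - x) * word_series (drop i w) x))"

text \<open>The letter \<open>w ! i\<close> heads the suffix in term \<open>i\<close> and, dualized,
  the reversed prefix in term \<open>i + 1\<close>. Differentiation strips it in both, leaving the
  same product with opposite signs (inner derivative of \<open>1 - x\<close>), so everything cancels
  in pairs.\<close>

lemma split_sum_derivative:
  assumes w: "set w \<subseteq> {-1..1/2}" "w \<noteq> []" "last w \<noteq> 0" and x: "0 < x" "x < 1"
  shows "(split_sum w has_real_derivative 0) (at x)"
proof -
  define r where "r = length w"
  define G where "G i x = dual_sign (take i w) * word_series (dual_word (take i w)) (1 - x)" for i x
  define K where "K i x = word_series (drop i w) x" for i x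
  define f where "f i = form_density (w ! i) x" for i
  have K: "(K i has_real_derivative f i * K (Suc i) x) (at x)" if "i < r" for i
  proof -
    have d: "drop i w = w ! i # drop (Suc i) w" using that by (simp add: r_def Cons_nth_drop_Suc)
    have "set (drop i w) \<subseteq> {-1..1}" using w(1) set_drop_subset[of i w] by force
    moreover have "last (drop i w) \<noteq> 0" using w(3) that by (simp add: r_def)
    ultimately show ?thesis unfolding K_def f_def d using x
      by (intro word_series_has_derivative) auto
  qed
  have G: "(G (Suc i) has_real_derivative - f i * G i x) (at x)" if "i < r" for i
  proof -
    let ?b = "w ! i" let ?u = "dual_word (take i w)"
    have b: "?b \<in> {-1..1/2}" using w(1) that nth_mem[of i w] by (auto simp: r_def simp del: nth_mem)
    have t: "take (Suc i) w = take i w @ [?b]" using that by (simp add: r_def take_Suc_conv_app_nth)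
    have du: "dual_word (take (Suc i) w) = dual_letter ?b # ?u" by (simp add: t dual_word_def)
    have s: "dual_sign (take (Suc i) w) = (if ?b = 0 then 1 else -1) * dual_sign (take i w)"
      by (simp add: t dual_sign_def)
    have "set (take (Suc i) w) \<subseteq> {-1..1/2}" using w(1) set_take_subset[of "Suc i" w] by blast
    then have rng: "set (dual_letter ?b # ?u) \<subseteq> {-1..1}" using dual_word_range du by metis
    have "hd w \<in> {-1..1/2}" using w by (metis hd_in_set subsetD)
    moreover have "last (dual_letter ?b # ?u) = dual_letter (hd w)"
      unfolding du[symmetric] using w(2) by (cases w) (auto simp: dual_word_def)
    ultimately have "last (dual_letter ?b # ?u) \<noteq> 0" using dual_letter_nonzero by metis
    then have "(word_series (dual_letter ?b # ?u) has_real_derivative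
        form_density (dual_letter ?b) (1 - x) * word_series ?u (1 - x)) (at (1 - x))"
      using rng x by (intro word_series_has_derivative) auto
    then have "((\<lambda>x. word_series (dual_letter ?b # ?u) (1 - x)) has_real_derivative
        form_density (dual_letter ?b) (1 - x) * word_series ?u (1 - x) * (- 1)) (at x)"
      by (rule DERIV_chain2) (auto intro!: derivative_eq_intros)
    then have "(G (Suc i) has_real_derivative dual_sign (take (Suc i) w) *
        (form_density (dual_letter ?b) (1 - x) * word_series ?u (1 - x) * (- 1))) (at x)"
      unfolding G_def du by (rule DERIV_cmult)
    moreover have "dual_sign (take (Suc i) w) *
        (form_density (dual_letter ?b) (1 - x) * word_series ?u (1 - x) * (- 1)) = - f i * G i x"
      unfolding f_def form_density_dual[OF b x] G_def s by simp
    ultimately show ?thesis by simp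
  qed
  \<comment> \<open>\<open>G'\<close> at 0 and \<open>K'\<close> at \<open>r\<close> are 0 because
    the word there is empty and its series constant.\<close>
  define G' where "G' i = (case i of 0 \<Rightarrow> 0 | Suc j \<Rightarrow> - f j * G j x)" for i
  define K' where "K' i = (if i < r then f i * K (Suc i) x else 0)" for i
  have G': "(G i has_real_derivative G' i) (at x)" if "i \<le> r" for i
    using that G by (cases i) (auto simp: G'_def G_def[abs_def] dual_word_def)
  have K': "(K i has_real_derivative K' i) (at x)" if "i \<le> r" for i
  proof (cases "i < r")
    case False
    then have "K i = (\<lambda>x. 1)" using that by (simp add: K_def r_def fun_eq_iff)
    then show ?thesis using False by (simp add: K'_def)
  qed (use K in \<open>simp add: K'_def\<close>)
  have "((\<lambda>x. \<Sum>i\<le>r. G i x * K i x) has_real_derivative (\<Sum>i\<le>r. G' i * K i x + K' i * G i x)) (at x)"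
    by (intro DERIV_sum DERIV_mult G' K') auto
  moreover have "(\<Sum>i\<le>r. G' i * K i x + K' i * G i x) = 0"
  proof -
    have "(\<Sum>i\<le>r. G' i * K i x) = (\<Sum>i<r. - f i * G i x * K (Suc i) x)"
      by (subst lessThan_Suc_atMost[symmetric], subst sum.lessThan_Suc_shift) (simp add: G'_def)
    moreover have "(\<Sum>i\<le>r. K' i * G i x) = (\<Sum>i<r. f i * K (Suc i) x * G i x)"
      by (subst lessThan_Suc_atMost[symmetric]) (simp add: K'_def)
    ultimately show ?thesis by (simp add: sum.distrib sum_negf algebra_simps)
  qed
  moreover have "split_sum w = (\<lambda>x. \<Sum>i\<le>r. G i x * K i x)"
    by (simp add: split_sum_def G_def K_def r_def fun_eq_iff mult.assoc)
  ultimately show ?thesis by simp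
qed

text \<open>Of the constant \<open>split_sum w\<close>, only the term with empty prefix survives at
  1 and only the one with empty suffix at 0.\<close>

theorem word_duality:
  assumes w: "set w \<subseteq> {-1..1/2}" "w \<noteq> []" "last w \<noteq> 0"
  shows "summable (word_coeff w)" and "summable (word_coeff (dual_word w))"
    and "suminf (word_coeff w) = dual_sign w * suminf (word_coeff (dual_word w))"
proof -
  have w': "set w \<subseteq> {-1..1}" using w(1) by force
  have dw: "set (dual_word w) \<subseteq> {-1..1}" by (rule dual_word_range[OF w(1)])
  have "hd w \<in> {-1..1/2}" using w by (metis hd_in_set subsetD)
  then show sw: "summable (word_coeff w)" using w w' by (intro summable_word_coeff) auto
  have "hd (dual_word w) = dual_letter (last w)" using w(2) by (simp add: dual_word_def hd_rev last_map)
  then show sd: "summable (word_coeff (dual_word w))"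
    using w(2) dw dual_letter_neq_1[OF w(3)] by (intro summable_word_coeff) (auto simp: dual_word_def)
  have tk: "set (dual_word (take i w)) \<subseteq> {-1..1}" for i
    using w(1) set_take_subset[of i w] by (intro dual_word_range) blast
  have dr: "set (drop i w) \<subseteq> {-1..1}" for i using w' set_drop_subset[of i w] by blast
  have "\<exists>c. \<forall>x\<in>{0<..<1}. split_sum w x = c"
  proof (rule has_field_derivative_zero_constant)
    fix x :: real assume "x \<in> {0<..<1}"
    then show "(split_sum w has_real_derivative 0) (at x within {0<..<1})"
      using split_sum_derivative[OF w, of x] by (auto intro: has_field_derivative_at_within)
  qed simp
  then obtain c where c: "\<And>x. 0 < x \<Longrightarrow> x < 1 \<Longrightarrow> split_sum w x = c" by auto
  have lim: "L = c" if "(h \<longlongrightarrow> L) (at_left 1)" "\<And>x. 0 < x \<Longrightarrow> x < 1 \<Longrightarrow> h x = c" for h :: "real \<Rightarrow> real" and L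
  proof (rule tendsto_unique[OF _ that(1)])
    have "\<forall>\<^sub>F x in at_left 1. h x = c"
      using eventually_at_left_real[of 0 1] by (auto elim!: eventually_mono simp: that(2))
    then show "(h \<longlongrightarrow> c) (at_left 1)" by (rule tendsto_eventually)
  qed simp
  have abel: "(word_series v \<longlongrightarrow> suminf (word_coeff v)) (at_left 1)" if "summable (word_coeff v)" for v
    unfolding word_series_def using that by (intro Abel_limit summable_sums)
  have "((\<lambda>x. split_sum w x) \<longlongrightarrow> (\<Sum>i\<le>length w. if i = 0 then suminf (word_coeff w) else 0)) (at_left 1)"
    unfolding split_sum_def
  proof (rule tendsto_sum)
    fix i
    show "((\<lambda>x. dual_sign (take i w) *
        (word_series (dual_word (take i w)) (1 - x) * word_series (drop i w) x)) \<longlongrightarrow>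
        (if i = 0 then suminf (word_coeff w) else 0)) (at_left 1)"
    proof (cases "i = 0")
      case True
      then show ?thesis using abel[OF sw] by (simp add: dual_sign_def dual_word_def)
    next
      case False
      then have "((\<lambda>x. word_series (dual_word (take i w)) (1 - x) * word_series (drop i w) x) \<longlongrightarrow> 0) (at_left 1)"
        using w(2) by (intro word_series_cross_term_tendsto_0 tk dr) simp
      then show ?thesis using False by (simp add: tendsto_mult_right_zero)
    qed
  qed
  then have "suminf (word_coeff w) = c" using lim[of "split_sum w"] c by simp
  \<comment> \<open>Replacing \<open>x\<close> by \<open>1 - x\<close> turns the behaviour at 0 into
    a limit at 1; prefix and suffix exchange roles, so the same cross-term estimate applies.\<close>
  moreover have "((\<lambda>x. split_sum w (1 - x)) \<longlongrightarrow>
     (\<Sum>i\<le>length w. if i = length w then dual_sign w * suminf (word_coeff (dual_word w)) else 0)) (at_left 1)"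
    unfolding split_sum_def
  proof (rule tendsto_sum)
    fix i
    show "((\<lambda>x. dual_sign (take i w) *
        (word_series (dual_word (take i w)) (1 - (1 - x)) * word_series (drop i w) (1 - x))) \<longlongrightarrow>
        (if i = length w then dual_sign w * suminf (word_coeff (dual_word w)) else 0)) (at_left 1)"
      if "i \<in> {..length w}"
    proof (cases "i = length w")
      case True
      then show ?thesis using abel[OF sd] by (simp add: tendsto_mult_left)
    next
      case False
      then have "((\<lambda>x. word_series (drop i w) (1 - x) * word_series (dual_word (take i w)) x) \<longlongrightarrow> 0) (at_left 1)"
        using that by (intro word_series_cross_term_tendsto_0 tk dr) auto
      then show ?thesis using False by (simp add: mult.commute tendsto_mult_right_zero)
    qed
  qed
  then have "dual_sign w * suminf (word_coeff (dual_word w)) = c"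
    using lim[of "\<lambda>x. split_sum w (1 - x)"] c by simp
  ultimately show "suminf (word_coeff w) = dual_sign w * suminf (word_coeff (dual_word w))" by simp
qed

section \<open>Multiple polylogarithms as word series\<close>

lemma finite_mpl_indices: "finite (mpl_indices r N)"
  by (rule finite_subset[OF _ finite_lists_length_eq[of "{1..N}" r]]) (auto simp: mpl_indices_def)

lemma mpl_partial_Nil [simp]: "mpl_partial [] z N = 1"
proof -
  have "mpl_indices 0 N = {[]}" by (auto simp: mpl_indices_def)
  then show ?thesis by (simp add: mpl_partial_def)
qed

lemma mpl_partial_Cons_0 [simp]: "mpl_partial (s # ss) z 0 = 0"
proof -
  have "mpl_indices (Suc r) 0 = {}" for r by (auto simp: mpl_indices_def)
  then show ?thesis by (simp add: mpl_partial_def)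
qed

text \<open>Cases on whether the largest index equals \<open>N + 1\<close>; strict decrease then
  confines the others to \<open>{1..N}\<close>.\<close>

lemma mpl_indices_Suc_Suc:
  "mpl_indices (Suc r) (Suc N) = mpl_indices (Suc r) N \<union> (#) (Suc N) ` mpl_indices r N"
proof (rule set_eqI)
  fix ns
  show "ns \<in> mpl_indices (Suc r) (Suc N) \<longleftrightarrow> ns \<in> mpl_indices (Suc r) N \<union> (#) (Suc N) ` mpl_indices r N"
  proof (cases ns)
    case Nil
    then show ?thesis by (auto simp: mpl_indices_def)
  next
    case (Cons n ms)
    have Cons_iff: "n # ms \<in> mpl_indices (Suc r) K \<longleftrightarrow> length ms = r \<and> sorted_wrt (>) ms \<and>
        (\<forall>x\<in>set ms. 1 \<le> x \<and> x < n) \<and> 1 \<le> n \<and> n \<le> K" for K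
      by (fastforce simp: mpl_indices_def subset_eq)
    have tail_iff: "ms \<in> mpl_indices r N \<longleftrightarrow> length ms = r \<and> sorted_wrt (>) ms \<and>
        (\<forall>x\<in>set ms. 1 \<le> x \<and> x < Suc N)"
      by (auto simp: mpl_indices_def subset_eq)
    have "ns \<in> (#) (Suc N) ` mpl_indices r N \<longleftrightarrow> n = Suc N \<and> ms \<in> mpl_indices r N"
      by (auto simp: Cons)
    then show ?thesis
      unfolding Un_iff Cons Cons_iff tail_iff le_Suc_eq by auto
  qed
qed

lemma mpl_partial_Cons_Suc:
  "mpl_partial (s # ss) (z # zs) (Suc N) =
     mpl_partial (s # ss) (z # zs) N + z ^ Suc N / real (Suc N) ^ s * mpl_partial ss zs N"
proof -
  let ?r = "length ss"
  let ?f = "\<lambda>ns. \<Prod>i<Suc ?r. (z # zs) ! i ^ (ns ! i) / real (ns ! i) ^ ((s # ss) ! i)"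
  have "mpl_indices (Suc ?r) N \<inter> (#) (Suc N) ` mpl_indices ?r N = {}"
    by (auto simp: mpl_indices_def)
  then have "mpl_partial (s # ss) (z # zs) (Suc N) =
      mpl_partial (s # ss) (z # zs) N + (\<Sum>ns\<in>(#) (Suc N) ` mpl_indices ?r N. ?f ns)"
    unfolding mpl_partial_def list.size add_0_right add_Suc_right mpl_indices_Suc_Suc
    by (intro sum.union_disjoint) (auto simp: finite_mpl_indices)
  also have "(\<Sum>ns\<in>(#) (Suc N) ` mpl_indices ?r N. ?f ns) =
      (\<Sum>ns\<in>mpl_indices ?r N. z ^ Suc N / real (Suc N) ^ s *
         (\<Prod>i<?r. zs ! i ^ (ns ! i) / real (ns ! i) ^ (ss ! i)))"
    by (subst sum.reindex) (auto simp: prod.lessThan_Suc_shift simp del: prod.lessThan_Suc)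
  finally show ?thesis by (simp add: mpl_partial_def sum_distrib_left)
qed

text \<open>The argument \<open>q\<close> accumulates the product of the arguments already consumed.\<close>

fun li_word :: "real \<Rightarrow> nat list \<Rightarrow> real list \<Rightarrow> real list" where
  "li_word q (s # ss) (z # zs) = replicate (s - 1) 0 @ (q * z) # li_word (q * z) ss zs"
| "li_word q _ _ = []"

lemma word_coeff_replicate_0:
  "word_coeff (replicate d 0 @ w) n = word_coeff w n / real n ^ d"
  by (induction d) auto

text \<open>The coefficient at \<open>n\<close> collects the index lists with
  \<open>n\<^sub>1 = n\<close>, scaled by \<open>q ^ n\<close>. The start value \<open>q\<close> is
  general because the tail of the word starts from \<open>q * z\<close>.\<close>

lemma sum_word_coeff_li_word:
  assumes "length zs = length ss" "\<forall>s\<in>set ss. s \<ge> 1" "0 \<notin> set zs" "q \<noteq> 0"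
  shows "(\<Sum>n\<le>N. word_coeff (li_word q ss zs) n / q ^ n) = mpl_partial ss zs N"
  using assms
proof (induction ss arbitrary: zs q N)
  case Nil
  then show ?case by (simp add: sum.atMost_shift)
next
  case (Cons s ss)
  then obtain z zs' where zs: "zs = z # zs'" by (cases zs) auto
  define w where "w = li_word (q * z) ss zs'"
  have nz: "q * z \<noteq> 0" and s: "s \<ge> 1" using Cons.prems by (auto simp: zs)
  have IH: "(\<Sum>n\<le>N. word_coeff w n / (q * z) ^ n) = mpl_partial ss zs' N" for N
    unfolding w_def using Cons.prems nz by (intro Cons.IH) (auto simp: zs)
  have step: "word_coeff (li_word q (s # ss) zs) (Suc N) / q ^ Suc N =
      z ^ Suc N / real (Suc N) ^ s * mpl_partial ss zs' N" for N
  proof -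
    \<comment> \<open>Factoring out the power leaves the scaled sum of the induction hypothesis up
      to \<open>N\<close>, that is, over indices below \<open>n\<^sub>1 = N + 1\<close>.\<close>
    have "(\<Sum>j<Suc N. (q * z) ^ (Suc N - j) * word_coeff w j) =
        (q * z) ^ Suc N * (\<Sum>n\<le>N. word_coeff w n / (q * z) ^ n)"
      unfolding sum_distrib_left lessThan_Suc_atMost
      by (intro sum.cong refl) (use nz in \<open>simp add: power_diff del: power_Suc\<close>)
    then have "word_coeff (li_word q (s # ss) zs) (Suc N) =
        (q * z) ^ Suc N * mpl_partial ss zs' N / (real (Suc N) * real (Suc N) ^ (s - 1))"
      using nz unfolding IH by (simp add: zs word_coeff_replicate_0 flip: w_def
          del: power_Suc of_nat_Suc sum.lessThan_Suc mult_eq_0_iff)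
    also have "real (Suc N) * real (Suc N) ^ (s - 1) = real (Suc N) ^ s"
      using s by (cases s) simp_all
    finally show ?thesis using nz by (simp add: power_mult_distrib del: power_Suc)
  qed
  show ?case
  proof (induction N)
    case 0
    have "li_word q (s # ss) zs \<noteq> []" by (simp add: zs)
    then show ?case by (simp add: zs)
  next
    case (Suc N)
    show ?case
      unfolding sum.atMost_Suc Suc step by (simp add: zs mpl_partial_Cons_Suc del: power_Suc)
  qed
qed

lemma mpl_partial_eq_sum_word_coeff:
  assumes "length zs = length ss" "\<forall>s\<in>set ss. s \<ge> 1" "0 \<notin> set zs"
  shows "mpl_partial ss zs N = (\<Sum>n\<le>N. word_coeff (li_word 1 ss zs) n)"
  using sum_word_coeff_li_word[of zs ss 1] assms by simp

lemma mpl_partial_tendsto: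
  assumes "length zs = length ss" "\<forall>s\<in>set ss. s \<ge> 1" "0 \<notin> set zs"
    and "summable (word_coeff (li_word 1 ss zs))"
  shows "mpl_partial ss zs \<longlonglongrightarrow> suminf (word_coeff (li_word 1 ss zs))"
  using assms(4) unfolding mpl_partial_eq_sum_word_coeff[OF assms(1-3), abs_def]
  using summable_sums sums_def_le by blast

section \<open>Words of concatenated lists and running products\<close>

lemma li_word_append:
  "length ss = length zs \<Longrightarrow>
     li_word q (ss @ ss') (zs @ zs') = li_word q ss zs @ li_word (q * prod_list zs) ss' zs'"
  by (induction ss zs arbitrary: q rule: list_induct2) (auto simp: mult.assoc)

lemma li_word_ones [simp]: "li_word q (replicate d (Suc 0)) (ones d) = replicate d q"
  by (induction d) auto

text \<open>With all exponents 1 no letter 0 is inserted, so the word is the list of running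
  products. The right-hand side has this shape.\<close>

abbreviation partial_products :: "real \<Rightarrow> real list \<Rightarrow> real list" where
  "partial_products q zs \<equiv> li_word q (ones (length zs)) zs"

lemma length_partial_products: "length (partial_products q zs) = length zs"
  by (induction zs arbitrary: q) auto

lemma partial_products_append:
  "partial_products q (xs @ ys) = partial_products q xs @ partial_products (q * prod_list xs) ys"
  by (simp add: replicate_add li_word_append)

lemma partial_products_butlast:
  "partial_products q (butlast zs) = butlast (partial_products q zs)"
proof (cases zs rule: rev_cases)
  case (snoc ys y)
  then show ?thesis by (simp only: partial_products_append) (simp add: butlast_append)
qed simp

lemma partial_products_nonzero: "0 \<notin> set (partial_products q zs) \<Longrightarrow> 0 \<notin> set zs"
  by (induction zs arbitrary: q) auto

lemma prod_list_ones [simp]: "prod_list (ones d) = (1::real)"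
  by (induction d) auto

lemma prod_list_diamond [simp]: "prod_list (diamond u p v) = u * v"
  by (simp add: diamond_def)

text \<open>The entry \<open>u\<close> cancels the running product \<open>q\<close>, which stays 1
  for \<open>p\<close> steps until \<open>v\<close> takes over; for \<open>p = 0\<close> the merged
  entry leads from \<open>q\<close> straight to \<open>v\<close>.\<close>

lemma partial_products_diamond:
  assumes "q * u = 1"
  shows "partial_products q (diamond u p v) = replicate p 1 @ [v]"
proof (cases p)
  case 0
  then show ?thesis using assms by (simp add: diamond_def flip: mult.assoc)
next
  case (Suc n)
  have "partial_products q (diamond u p v) = partial_products q ([u] @ ones n @ [v])"
    by (simp add: diamond_def Suc)
  also have "\<dots> = replicate p 1 @ [v]"
    unfolding partial_products_append using assms by (simp add: Suc)
  finally show ?thesis .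
qed

section \<open>The words of the two sides of the identity\<close>

definition block_word :: "nat \<Rightarrow> (nat \<Rightarrow> nat) \<Rightarrow> (nat \<Rightarrow> nat) \<Rightarrow> (nat \<Rightarrow> real) \<Rightarrow> real list" where
  "block_word k p m a =
     concat (map (\<lambda>i. replicate (p i) 0 @ replicate (m (i + 1)) (a (i + 1))) [1..<k + 1])"

lemma block_word_Suc:
  "block_word (Suc k) p m a = block_word k p m a @ replicate (p (k + 1)) 0 @ replicate (m (k + 2)) (a (k + 2))"
  by (simp add: block_word_def)

lemma replicate_minus_1_Cons: "n \<ge> 1 \<Longrightarrow> x # replicate (n - 1) x = replicate n x"
  by (cases n) auto

lemma length_block_word: "length (block_word k p m a) = (\<Sum>i = 1..k. p i) + (\<Sum>i = 2..k + 1. m i)"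
  by (induction k) (auto simp: block_word_Suc block_word_def)

lemma dual_sign_append: "dual_sign (v @ w) = dual_sign v * dual_sign w"
  by (simp add: dual_sign_def power_add)

lemma dual_sign_replicate: "dual_sign (replicate n b) = (if b = 0 then 1 else (-1) ^ n)"
  by (simp add: dual_sign_def)

lemma dual_sign_block_word:
  assumes "\<And>i. i \<in> {2..k + 1} \<Longrightarrow> a i \<noteq> 0"
  shows "dual_sign (block_word k p m a) = (-1) ^ (\<Sum>i = 2..k + 1. m i)"
  using assms
proof (induction k)
  case 0
  then show ?case by (simp add: block_word_def dual_sign_def)
next
  case (Suc k)
  then show ?case by (simp add: block_word_Suc dual_sign_append dual_sign_replicate power_add)
qed

text \<open>The quotients telescope: the nonzero letters of block \<open>i\<close> are all
  \<open>a (i + 1)\<close>. The induction carries the total product as start value of the next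
  block; \<open>ss\<close> and \<open>zs\<close> are functions so that \<open>k\<close> can
  vary.\<close>

lemma li_word_blocks:
  fixes p m :: "nat \<Rightarrow> nat" and a :: "nat \<Rightarrow> real"
  assumes "\<And>i. i \<in> {2..k + 1} \<Longrightarrow> m i \<ge> 1" "\<And>i. i \<in> {1..k + 1} \<Longrightarrow> a i \<noteq> 0"
  defines "ss \<equiv> (\<lambda>k. concat (map (\<lambda>i. [p i + 1] @ ones (m (i + 1) - 1)) [1..<k + 1]))"
    and "zs \<equiv> (\<lambda>k. concat (map (\<lambda>i. [a (i + 1) / a i] @ ones (m (i + 1) - 1)) [1..<k + 1]))"
  shows "length (ss k) = length (zs k) \<and> a 1 * prod_list (zs k) = a (k + 1) \<and>
         li_word (a 1) (ss k) (zs k) = block_word k p m a"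
  using assms(1,2)
proof (induction k)
  case 0
  then show ?case by (simp add: ss_def zs_def block_word_def)
next
  case (Suc k)
  then have IH: "length (ss k) = length (zs k)" "a 1 * prod_list (zs k) = a (k + 1)"
      "li_word (a 1) (ss k) (zs k) = block_word k p m a" by auto
  have nz: "a (k + 1) \<noteq> 0" and m: "m (k + 2) \<ge> 1" using Suc.prems by auto
  have ss: "ss (Suc k) = ss k @ [p (k + 1) + 1] @ ones (m (k + 2) - 1)" by (simp add: ss_def)
  have zs: "zs (Suc k) = zs k @ [a (k + 2) / a (k + 1)] @ ones (m (k + 2) - 1)" by (simp add: zs_def)
  have "a 1 * prod_list (zs (Suc k)) = (a 1 * prod_list (zs k)) * (a (k + 2) / a (k + 1))"
    by (simp add: zs)
  also have "\<dots> = a (k + 2)" using nz unfolding IH by simp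
  finally have prod: "a 1 * prod_list (zs (Suc k)) = a (Suc k + 1)" by simp
  have "li_word (a 1) (ss (Suc k)) (zs (Suc k)) =
      block_word k p m a @ replicate (p (k + 1)) 0 @ a (k + 2) # replicate (m (k + 2) - 1) (a (k + 2))"
    unfolding ss zs li_word_append[OF IH(1)] IH(2,3) using nz by simp
  then have "li_word (a 1) (ss (Suc k)) (zs (Suc k)) = block_word (Suc k) p m a"
    unfolding replicate_minus_1_Cons[OF m] block_word_Suc .
  then show ?case using prod IH(1) by (simp add: ss zs)
qed

lemma
  assumes k: "k \<ge> 1" and m: "\<And>i. i \<in> {2..k + 1} \<Longrightarrow> m i \<ge> 1"
    and a: "\<And>i. i \<in> {1..k + 1} \<Longrightarrow> a i \<noteq> 0"
  shows length_x_args: "length (x_args k m a) = length (lhs_index k p m)"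
    and li_word_x_args:
      "li_word 1 (lhs_index k p m) (x_args k m a) = replicate (m 1) (a 1) @ block_word k p m a"
proof -
  define ss where "ss = concat (map (\<lambda>i. [p i + 1] @ ones (m (i + 1) - 1)) [1..<k + 1])"
  define zs where "zs = concat (map (\<lambda>i. [a (i + 1) / a i] @ ones (m (i + 1) - 1)) [1..<k + 1])"
  define zs' where "zs' = ones (m 2 - 1) @
     concat (map (\<lambda>i. [a (i + 1) / a i] @ ones (m (i + 1) - 1)) [2..<k + 1])"
  have len: "length ss = length zs" and w: "li_word (a 1) ss zs = block_word k p m a"
    using li_word_blocks[of k m a p] m a unfolding ss_def zs_def by auto
  have up: "[1..<k + 1] = 1 # [2..<k + 1]" using k by (simp add: upt_conv_Cons numeral_2_eq_2)
  have zs: "zs = (a 2 / a 1) # zs'" unfolding zs_def up zs'_def by (simp add: numeral_2_eq_2)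
  have lhs: "lhs_index k p m = ones (m 1) @ ss" by (simp add: lhs_index_def ss_def)
  have "length (x_args k m a) = length (lhs_index k p m) \<and>
      li_word 1 (lhs_index k p m) (x_args k m a) = replicate (m 1) (a 1) @ block_word k p m a"
  proof (cases "m 1")
    case 0
    then have x: "x_args k m a = (a 1 * (a 2 / a 1)) # zs'" by (simp add: x_args_def diamond_def zs'_def)
    obtain s ss' where ss: "ss = s # ss'" using len zs by (cases ss) auto
    \<comment> \<open>Starting at 1 with the merged entry \<open>a 1 * (a 2 / a 1)\<close> gives the
      same running product as starting at \<open>a 1\<close> with \<open>a 2 / a 1\<close>.\<close>
    have "li_word 1 ss (x_args k m a) = li_word (a 1) ss zs" by (simp add: x ss zs)
    then show ?thesis using 0 len w by (simp add: lhs x zs)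
  next
    case (Suc n)
    then have x: "x_args k m a = (a 1 # ones n) @ zs" by (simp add: x_args_def diamond_def zs zs'_def)
    have "li_word 1 (lhs_index k p m) (x_args k m a) =
        li_word 1 (ones (m 1)) (a 1 # ones n) @ li_word (a 1) ss zs"
      unfolding lhs x by (subst li_word_append) (simp_all add: Suc[unfolded One_nat_def])
    then show ?thesis using len w by (simp add: lhs x Suc[unfolded One_nat_def])
  qed
  then show "length (x_args k m a) = length (lhs_index k p m)"
    and "li_word 1 (lhs_index k p m) (x_args k m a) = replicate (m 1) (a 1) @ block_word k p m a"
    by auto
qed

lemma zero_notin_x_args:
  assumes "k \<ge> 1" "\<And>i. i \<in> {1..k + 1} \<Longrightarrow> a i \<noteq> 0"
  shows "0 \<notin> set (x_args k m a)"
  using assms(1) assms(2)[of 1] assms(2)[of 2] assms(2)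
  by (auto simp: x_args_def diamond_def)

text \<open>The running product after the \<open>i\<close>-th block is \<open>b (k + 1 - i)\<close>.
  Blocks are numbered from the far end, so raising \<open>k\<close> adds one in front, as reversal
  does in the dual word. The final product \<open>b 1\<close> stands for a single letter
  \<open>a 1\<close>, whatever \<open>m 1\<close> is.\<close>

lemma partial_products_A_blocks:
  fixes p m :: "nat \<Rightarrow> nat" and a :: "nat \<Rightarrow> real"
  assumes "\<And>i. i \<in> {2..k + 1} \<Longrightarrow> m i \<ge> 1" "\<And>i. i \<in> {1..k + 1} \<Longrightarrow> a i \<noteq> 0 \<and> a i \<noteq> 1"
  defines "b \<equiv> (\<lambda>i. a i / (a i - 1))"
    and "R \<equiv> (\<lambda>k. concat (map (A_block k p m a) [1..<k + 1]))"
  shows "b (k + 1) * prod_list (R k) = b 1 \<and>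
         partial_products 1 (b (k + 1) # R k) = dual_word (a 1 # block_word k p m a)"
  using assms(1,2)
proof (induction k)
  case 0
  then show ?case by (simp add: R_def b_def dual_word_def dual_letter_def block_word_def)
next
  case (Suc k)
  then have IH: "b (k + 1) * prod_list (R k) = b 1"
     "partial_products 1 (b (k + 1) # R k) = dual_word (a 1 # block_word k p m a)" by auto
  have a: "a (k + 1) \<noteq> 0" "a (k + 2) \<noteq> 0" "a (k + 2) \<noteq> 1" and m: "m (k + 2) \<ge> 1"
    using Suc.prems by auto
  let ?u = "(a (k + 2) - 1) / a (k + 2)"
  let ?d = "diamond ?u (p (k + 1)) (b (k + 1))"
  have bu: "b (k + 2) * ?u = 1" using a by (simp add: b_def)
  have "[1..<Suc k + 1] = 1 # map Suc [1..<k + 1]" by (simp add: upt_conv_Cons map_Suc_upt del: upt_Suc)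
  moreover have "A_block (Suc k) p m a (Suc i) = A_block k p m a i" for i
    by (simp add: A_block_def)
  moreover have "A_block (Suc k) p m a 1 = ones (m (k + 2) - 1) @ ?d"
    by (simp add: A_block_def b_def)
  ultimately have R: "R (Suc k) = ones (m (k + 2) - 1) @ ?d @ R k"
    unfolding R_def by (simp add: comp_def del: upt_Suc One_nat_def)
  have "b (k + 2) * prod_list (R (Suc k)) = (b (k + 2) * ?u) * (b (k + 1) * prod_list (R k))"
    by (simp add: R mult_ac)
  also have "\<dots> = b 1" unfolding bu IH by simp
  finally have prod: "b (k + 2) * prod_list (R (Suc k)) = b 1" .
  have "partial_products 1 (b (k + 2) # R (Suc k)) =
     partial_products 1 ([b (k + 2)] @ ones (m (k + 2) - 1) @ ?d @ R k)" by (simp add: R)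
  also have "\<dots> = [b (k + 2)] @ replicate (m (k + 2) - 1) (b (k + 2)) @
      partial_products (b (k + 2)) ?d @ partial_products (b (k + 1)) (R k)"
    unfolding partial_products_append using bu by (simp flip: mult.assoc)
  also have "\<dots> = (b (k + 2) # replicate (m (k + 2) - 1) (b (k + 2))) @ replicate (p (k + 1)) 1 @
      partial_products 1 (b (k + 1) # R k)"
    unfolding partial_products_diamond[OF bu] by simp
  also have "\<dots> = dual_word (a 1 # block_word (Suc k) p m a)"
    unfolding IH replicate_minus_1_Cons[OF m] block_word_Suc using a
    by (simp add: dual_word_def dual_letter_def b_def)
  finally show ?case using prod by simp
qed

text \<open>The blocks account for exactly one \<open>a 1\<close>: deleting the last entry removes
  it if \<open>m 1 = 0\<close>, and otherwise the final ones add the remaining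
  \<open>m 1 - 1\<close> copies.\<close>

lemma partial_products_y_args:
  assumes "\<And>i. i \<in> {2..k + 1} \<Longrightarrow> m i \<ge> 1" "\<And>i. i \<in> {1..k + 1} \<Longrightarrow> a i \<noteq> 0 \<and> a i \<noteq> 1"
  shows "partial_products 1 (y_args k p m a) = dual_word (replicate (m 1) (a 1) @ block_word k p m a)"
proof -
  define y where "y = [a (k + 1) / (a (k + 1) - 1)] @ concat (map (A_block k p m a) [1..<k + 1])"
  have y: "prod_list y = a 1 / (a 1 - 1)"
      "partial_products 1 y = dual_word (a 1 # block_word k p m a)"
    using partial_products_A_blocks[of k m a p] assms by (simp_all add: y_def)
  show ?thesis
  proof (cases "m 1")
    case 0
    then have "y_args k p m a = butlast y" by (simp add: y_args_def y_def)
    then show ?thesis using 0 by (simp only: partial_products_butlast y) (simp add: dual_word_def)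
  next
    case (Suc n)
    then have "y_args k p m a = y @ ones n" by (simp add: y_args_def y_def Let_def)
    then have "partial_products 1 (y_args k p m a) =
        dual_word (a 1 # block_word k p m a) @ replicate n (a 1 / (a 1 - 1))"
      by (simp only: partial_products_append y) simp
    then show ?thesis using Suc assms(2)[of 1]
      by (simp add: dual_word_def dual_letter_def replicate_append_same)
  qed
qed

theorem theorem2p3:
  fixes k :: nat and p m :: "nat \<Rightarrow> nat" and a :: "nat \<Rightarrow> real" and M P :: nat
  assumes "k \<ge> 1"
    and "\<And>i. i \<in> {2..k + 1} \<Longrightarrow> m i \<ge> 1"
    and "\<And>i. i \<in> {1..k + 1} \<Longrightarrow> a i \<in> {-1..1/2} - {0}"
    and "M = (\<Sum>i = 1..k + 1. m i)"
    and "P = (\<Sum>i = 1..k. p i)"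
  shows "Li_convergent (lhs_index k p m) (x_args k m a) \<and>
         Li_convergent (ones (M + P)) (y_args k p m a) \<and>
         Li (lhs_index k p m) (x_args k m a) = (-1) ^ M * Li (ones (M + P)) (y_args k p m a)"
proof -
  define w where "w = replicate (m 1) (a 1) @ block_word k p m a"
  let ?y = "y_args k p m a"
  have nz: "a i \<noteq> 0" "a i \<noteq> 1" if "i \<in> {1..k + 1}" for i using assms(3)[OF that] by auto
  have M: "M = m 1 + (\<Sum>i = 2..k + 1. m i)"
    unfolding assms(4) by (subst sum.atLeast_Suc_atMost) (simp_all add: numeral_2_eq_2)
  have x: "li_word 1 (lhs_index k p m) (x_args k m a) = w"
    and lx: "length (x_args k m a) = length (lhs_index k p m)"
    unfolding w_def using li_word_x_args[of k m a p] length_x_args[of k m a p] assms(1,2) nz by blast+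
  have y: "partial_products 1 ?y = dual_word w"
    unfolding w_def using assms(2) nz by (intro partial_products_y_args) auto
  have "length ?y = length w"
    using arg_cong[OF y, of length] unfolding length_partial_products by (simp add: dual_word_def)
  then have ly: "length ?y = M + P" by (simp add: w_def M assms(5) length_block_word)
  have w: "set w \<subseteq> {-1..1/2}"
    unfolding w_def block_word_def using assms(3)[of 1] assms(3)
    by (auto simp del: One_nat_def)
  \<comment> \<open>Since \<open>k \<ge> 1\<close> and \<open>m (k + 1) \<ge> 1\<close>, the last
    block ends in \<open>a (k + 1)\<close>, so the last letter of \<open>w\<close> is
    nonzero.\<close>
  obtain j where j: "k = Suc j" using assms(1) by (cases k) auto
  have "m (k + 1) \<ge> 1" using assms(1,2) by auto
  then have "w \<noteq> []" "last w = a (k + 1)" unfolding w_def j block_word_Suc by auto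
  then have w': "w \<noteq> []" "last w \<noteq> 0" using nz by auto
  note duality = word_duality[OF w w']
  have sign: "dual_sign w = (-1) ^ M"
    unfolding w_def dual_sign_append dual_sign_replicate M power_add
    using nz dual_sign_block_word[of k a p m] by simp
  have "mpl_partial (lhs_index k p m) (x_args k m a) \<longlonglongrightarrow> suminf (word_coeff w)"
    unfolding x[symmetric]
  proof (rule mpl_partial_tendsto)
    show "\<forall>s\<in>set (lhs_index k p m). 1 \<le> s" by (auto simp: lhs_index_def)
    show "0 \<notin> set (x_args k m a)" using assms(1) nz(1) by (rule zero_notin_x_args)
  qed (use lx x duality(1) in auto)
  moreover have "0 \<notin> set (dual_word w)"
    using w dual_letter_nonzero by (fastforce simp: dual_word_def)
  then have "0 \<notin> set ?y" using partial_products_nonzero[of 1 ?y] y by simp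
  then have "mpl_partial (ones (M + P)) ?y \<longlonglongrightarrow> suminf (word_coeff (dual_word w))"
    using mpl_partial_tendsto[of ?y "ones (M + P)"] duality(2) y unfolding ly by simp
  ultimately show ?thesis
    unfolding Li_convergent_def Li_def using duality(3) sign
    by (auto simp: limI convergentI)
qed

end
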